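(* Let $H<0$ and let $C>2(H+\sqrt{1+H^2})$ with $C\neq-\frac1H$. Then the axially symmetric constant mean curvature surface $\Sigma_{H,C}$ in $S^3$ is not embedded.
   Context: $S^3$ is the unit sphere in $\mathbb{R}^4$. For $H\in\mathbb{R}$ and $C>2(H+\sqrt{1+H^2})$ put $T=\frac{\pi}{\sqrt{1+H^2}}$ and $$g(t)=\sqrt{\frac{C-2H}{2+2H^2}+\frac{\sqrt{C^2-4CH-4}}{2+2H^2}\sin(2\sqrt{1+H^2}\,t)},$$ a positive $T$-periodic function satisfying $g'^2+g^2(1+(H+g^{-2})^2)=C$. Let $$\theta(t)=\int_{T/4}^{t}\frac{\sqrt{C}\,g(\tau)\,(H-g(\tau)^{-2})}{g'(\tau)^2+g(\tau)^2}\,d\tau$$ and let $\beta:\mathbb{R}\to\mathbb{R}^2$ be $$\beta=\frac{1}{\sqrt{C g'^2+Cg^2}}\Big(-\sqrt{C}\,g'\cos\theta-(Hg^2+1)\sin\theta,\ \sqrt{C}\,g'\sin\theta-(Hg^2+1)\cos\theta\Big).$$ The surface $\Sigma_{H,C}$ is the one given by the immersion $\phi:\mathbb{R}^2\to S^3$, $$\phi(s,t)=\big(\sqrt{1-|\beta(t)|^2}\cos s,\ \sqrt{1-|\beta(t)|^2}\sin s,\ \beta(t)\big).$$ $\Sigma_{H,C}$ is embedded if its image $\phi(\mathbb{R}^2)$ is an embedded two-dimensional smooth submanifold of $S^3$. *)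

theory Defs
  imports "HOL-Analysis.Analysis"
begin

(* C^k maps on an open set S, through iterated directional derivatives;
   only meaningful for open S, since the derivatives are taken "at x". *)
primrec Ck_on :: "nat \<Rightarrow> ('a::real_normed_vector \<Rightarrow> 'b::real_normed_vector) \<Rightarrow> 'a set \<Rightarrow> bool" where
  "Ck_on 0 f S \<longleftrightarrow> continuous_on S f"
| "Ck_on (Suc k) f S \<longleftrightarrow>
     (\<forall>x\<in>S. f differentiable (at x)) \<and>
     (\<forall>v. Ck_on k (\<lambda>x. frechet_derivative f (at x) v) S)"

definition smooth_map_on :: "('a::real_normed_vector \<Rightarrow> 'b::real_normed_vector) \<Rightarrow> 'a set \<Rightarrow> bool" where
  "smooth_map_on f S \<longleftrightarrow> (\<forall>k. Ck_on k f S)"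

definition smooth_diffeo :: "('a::euclidean_space \<Rightarrow> 'a) \<Rightarrow> 'a set \<Rightarrow> 'a set \<Rightarrow> bool" where
  "smooth_diffeo \<psi> U V \<longleftrightarrow>
     open U \<and> open V \<and> bij_betw \<psi> U V \<and>
     smooth_map_on \<psi> U \<and> smooth_map_on (inv_into U \<psi>) V"

(* M is a k-dimensional embedded smooth submanifold of the submanifold N of a Euclidean
   space: around each point of M there is a chart of the ambient space that straightens N
   to a linear subspace Q (so it restricts to a chart of N) and M to a k-dimensional
   linear subspace P of Q (so that chart of N is a slice chart for M).
   M carries the subspace topology and need not be closed in N. *)
definition embedded_submanifold :: "nat \<Rightarrow> 'a::euclidean_space set \<Rightarrow> 'a set \<Rightarrow> bool" where
  "embedded_submanifold k N M \<longleftrightarrow>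
     M \<subseteq> N \<and>
     (\<forall>p\<in>M. \<exists>U V \<psi> P Q.
        p \<in> U \<and> smooth_diffeo \<psi> U V \<and>
        subspace P \<and> subspace Q \<and> P \<subseteq> Q \<and> dim P = k \<and>
        \<psi> ` (U \<inter> N) = V \<inter> Q \<and> \<psi> ` (U \<inter> M) = V \<inter> P)"

definition period :: "real \<Rightarrow> real" where
  "period H = pi / sqrt (1 + H\<^sup>2)"

definition g :: "real \<Rightarrow> real \<Rightarrow> real \<Rightarrow> real" where
  "g H C t = sqrt ((C - 2 * H) / (2 + 2 * H\<^sup>2)
     + sqrt (C\<^sup>2 - 4 * C * H - 4) / (2 + 2 * H\<^sup>2) * sin (2 * sqrt (1 + H\<^sup>2) * t))"

(* The interval integral is oriented, as needed for t < T/4. *)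
definition theta :: "real \<Rightarrow> real \<Rightarrow> real \<Rightarrow> real" where
  "theta H C t = (LBINT \<tau>=ereal (period H / 4)..ereal t.
     sqrt C * g H C \<tau> * (H - 1 / (g H C \<tau>)\<^sup>2)
       / ((deriv (g H C) \<tau>)\<^sup>2 + (g H C \<tau>)\<^sup>2))"

definition beta :: "real \<Rightarrow> real \<Rightarrow> real \<Rightarrow> real^2" where
  "beta H C t =
     (1 / sqrt (C * (deriv (g H C) t)\<^sup>2 + C * (g H C t)\<^sup>2)) *\<^sub>R
     vector
       [- sqrt C * deriv (g H C) t * cos (theta H C t)
          - (H * (g H C t)\<^sup>2 + 1) * sin (theta H C t),
        sqrt C * deriv (g H C) t * sin (theta H C t)
          - (H * (g H C t)\<^sup>2 + 1) * cos (theta H C t)]"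

definition phi :: "real \<Rightarrow> real \<Rightarrow> real \<times> real \<Rightarrow> real^4" where
  "phi H C = (\<lambda>(s, t). vector
     [sqrt (1 - (norm (beta H C t))\<^sup>2) * cos s,
      sqrt (1 - (norm (beta H C t))\<^sup>2) * sin s,
      beta H C t $ 1,
      beta H C t $ 2])"

definition Sigma_embedded :: "real \<Rightarrow> real \<Rightarrow> bool" where
  "Sigma_embedded H C \<longleftrightarrow>
     embedded_submanifold 2 (sphere (0::real^4) 1) (range (phi H C))"

end

theory Submission
  imports Defs
begin

text \<open>
  Write \<open>X = g\<^sup>2\<close>, \<open>b = H X + 1\<close> and \<open>T\<close> for the period. The curve \<open>\<beta>\<close> is symmetric under
  reflection in the lines through 0 and its extremal points, so wherever it meets such a line
  between two consecutive extrema it crosses its mirror image; if moreover \<open>b \<noteq> 0\<close> there, the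
  crossing is transversal, since the angular momentum of \<open>\<beta>\<close> is \<open>b / (sqrt C g)\<close>. Then the image
  of \<open>\<phi>\<close> contains three curves with independent velocities at one point, so it is not an
  embedded surface.

  Such a crossing is forced by the bounds \<open>\<pi> < - 2 \<theta>(3 T / 4) < 2 \<pi>\<close> for the rotation over one
  period. To see them, factor \<open>g\<^sup>2 (g'\<^sup>2 + g\<^sup>2) = H\<^sup>2 (X - u1\<^sup>2) (u2\<^sup>2 - X)\<close>. Then
  \<open>- \<theta>' = u1 g / (X - u1\<^sup>2) + u2 g / (u2\<^sup>2 - X)\<close>, and \<open>u1\<^sup>2 / (X - u1\<^sup>2)\<close> and \<open>u2\<^sup>2 / (u2\<^sup>2 - X)\<close>
  both have elementary antiderivatives and integral \<open>\<pi> / 2\<close> over half a period. The lower bound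
  follows from \<open>g > u1\<close>; the upper bound follows from AM-GM, which makes the integrand linear
  in \<open>X\<close> and gives \<open>\<pi> (sqrt (1 + 1 / w) + sqrt (1 - 1 / w)) < 2 \<pi>\<close> with \<open>w = sqrt (1 + H\<^sup>2)\<close>.

  For \<open>H C > - 1\<close> the function \<open>b\<close> is positive and the intermediate value theorem applies directly.
  For \<open>H C < - 1\<close> it changes sign, and the crossing is found in the region \<open>b < 0\<close>.
\<close>

section \<open>Tangent vectors of embedded submanifolds; an elementary antiderivative\<close>

lemma has_vector_derivative_at_0_imp_tendsto:
  assumes "(f has_vector_derivative v) (at (0::real))"
  shows "((\<lambda>h. (1 / h) *\<^sub>R (f h - f 0)) \<longlongrightarrow> v) (at 0)"
proof (rule LIM_zero_cancel, rule tendsto_norm_zero_cancel, rule Lim_transform_eventually)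
  show "((\<lambda>h. norm (f h - f 0 - h *\<^sub>R v) / norm h) \<longlongrightarrow> 0) (at 0)"
    using assms by (simp add: has_vector_derivative_def has_derivative_at)
  have "norm (f h - f 0 - h *\<^sub>R v) / norm h = norm ((1 / h) *\<^sub>R (f h - f 0) - v)"
    if "h \<noteq> 0" for h
  proof -
    have "(1 / h) *\<^sub>R (f h - f 0) - v = (1 / h) *\<^sub>R (f h - f 0 - h *\<^sub>R v)"
      using that by (simp add: scaleR_diff_right)
    then show ?thesis by simp
  qed
  then show "\<forall>\<^sub>F h in at 0. norm (f h - f 0 - h *\<^sub>R v) / norm h
      = norm ((1 / h) *\<^sub>R (f h - f 0) - v)"
    by (auto simp: eventually_at_filter)
qed

lemma has_vector_derivative_vec:
  fixes f :: "real \<Rightarrow> real^'n"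
  assumes "\<And>i. ((\<lambda>t. f t $ i) has_real_derivative f' $ i) (at t)"
  shows "(f has_vector_derivative f') (at t)"
  unfolding has_vector_derivative_def
  by (subst has_derivative_componentwise_within)
     (use assms in \<open>auto simp: Basis_vec_def inner_axis has_field_derivative_def mult_commute_abs\<close>)

lemma vector_4:
  "(vector [x, y, z, u] :: 'a::zero^4) $ 1 = x"
  "(vector [x, y, z, u] :: 'a^4) $ 2 = y"
  "(vector [x, y, z, u] :: 'a^4) $ 3 = z"
  "(vector [x, y, z, u] :: 'a^4) $ 4 = u"
  unfolding vector_def by simp_all

text \<open>A straightening chart \<open>\<psi>\<close> maps curves in \<open>M\<close> through
  \<open>p\<close> into the subspace \<open>P\<close> near parameter 0. Its derivative at
  \<open>p\<close> is injective, because \<open>\<psi>\<close> has a differentiable inverse, so it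
  carries \<open>B\<close> to an independent set of the same size in \<open>P\<close>.\<close>

lemma embedded_submanifold_card_velocities_le:
  fixes M N :: "'a::euclidean_space set"
  assumes emb: "embedded_submanifold k N M"
    and B: "independent B"
    and vel: "\<And>v. v \<in> B \<Longrightarrow> \<exists>\<gamma>. \<gamma> (0::real) = p \<and> range \<gamma> \<subseteq> M \<and> (\<gamma> has_vector_derivative v) (at 0)"
    and p: "p \<in> M"
  shows "card B \<le> k"
proof -
  obtain U V \<psi> P where pU: "p \<in> U" and dif: "smooth_diffeo \<psi> U V"
    and P: "subspace P" "dim P = k" "\<psi> ` (U \<inter> M) = V \<inter> P"
    using emb p unfolding embedded_submanifold_def by blast
  have U: "open U" "open V" and bij: "bij_betw \<psi> U V"
    using dif by (auto simp: smooth_diffeo_def)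
  have "Ck_on 1 \<psi> U" "Ck_on 1 (inv_into U \<psi>) V"
    using dif by (auto simp: smooth_diffeo_def smooth_map_on_def)
  then have d1: "\<psi> differentiable (at p)" and d2: "inv_into U \<psi> differentiable (at (\<psi> p))"
    using pU bij by (auto simp: bij_betw_def)
  obtain L where L: "(\<psi> has_derivative L) (at p)"
    using d1 by (auto simp: differentiable_def)
  obtain L' where L': "(inv_into U \<psi> has_derivative L') (at (\<psi> p))"
    using d2 by (auto simp: differentiable_def)
  have "((inv_into U \<psi> \<circ> \<psi>) has_derivative L' \<circ> L) (at p)"
    using diff_chain_at[OF L L'] .
  then have "((\<lambda>x. x) has_derivative L' \<circ> L) (at p)"
    by (rule has_derivative_transform_within_open[OF _ U(1) pU])
       (use bij in \<open>auto simp: bij_betw_def inv_into_f_f\<close>)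
  then have "L' \<circ> L = (\<lambda>x. x)"
    using has_derivative_unique has_derivative_ident by blast
  then have inj: "inj L"
    by (metis comp_apply injI)
  have lin: "linear L"
    using L has_derivative_linear by blast
  have LP: "L v \<in> P" if v: "v \<in> B" for v
  proof -
    obtain \<gamma> where \<gamma>: "\<gamma> (0::real) = p" "range \<gamma> \<subseteq> M" "(\<gamma> has_vector_derivative v) (at 0)"
      using vel[OF v] by blast
    have "((\<psi> \<circ> \<gamma>) has_vector_derivative L v) (at 0)"
      using \<gamma> L by (intro vector_derivative_diff_chain_within) (auto intro: has_derivative_at_withinI)
    then have lim: "((\<lambda>h. (1 / h) *\<^sub>R (\<psi> (\<gamma> h) - \<psi> p)) \<longlongrightarrow> L v) (at 0)"
      using \<gamma>(1) has_vector_derivative_at_0_imp_tendsto by fastforce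
    have "isCont \<gamma> 0"
      using \<gamma>(3) has_vector_derivative_continuous by blast
    then have "\<forall>\<^sub>F h in at 0. \<gamma> h \<in> U"
      using U(1) pU \<gamma>(1) unfolding isCont_def by (metis topological_tendstoD)
    \<comment> \<open>Subspaces are closed, so the limit of these quotients stays in
      \<open>P\<close>.\<close>
    then have "\<forall>\<^sub>F h in at 0. (1 / h) *\<^sub>R (\<psi> (\<gamma> h) - \<psi> p) \<in> P"
    proof eventually_elim
      case (elim h)
      then have "\<psi> (\<gamma> h) \<in> P" "\<psi> p \<in> P"
        using \<gamma>(2) P(3) p pU by blast+
      then show ?case
        using P(1) by (simp add: subspace_diff subspace_scale)
    qed
    then show ?thesis
      using Lim_in_closed_set[OF closed_subspace[OF P(1)] _ _ lim] by simp
  qed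
  have "independent (L ` B)"
    using linear_independent_injective_image[OF lin B] inj by (simp add: inj_on_subset)
  then have "card (L ` B) \<le> dim P"
    using LP by (intro independent_card_le_dim) auto
  then show ?thesis
    using P(2) inj by (simp add: card_image inj_on_subset)
qed

text \<open>
  This antiderivative of \<open>1 / (A + d cos \<psi>)\<close> is smooth on the whole line, unlike the one obtained
  from the substitution \<open>tan (\<psi> / 2)\<close>.
\<close>
lemma has_real_derivative_psi_minus_arctan:
  fixes A d \<psi> :: real
  defines "S \<equiv> sqrt (A\<^sup>2 - d\<^sup>2)"
  assumes A: "\<bar>d\<bar> < A"
  shows "((\<lambda>\<psi>. \<psi> - 2 * arctan (d * sin \<psi> / (A + S + d * cos \<psi>)))
          has_real_derivative S / (A + d * cos \<psi>)) (at \<psi>)"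
proof -
  have dA: "d\<^sup>2 < A\<^sup>2"
    using A by (metis abs_ge_zero power2_abs power_strict_mono zero_less_numeral)
  then have S: "S > 0" "S\<^sup>2 = A\<^sup>2 - d\<^sup>2"
    by (auto simp: S_def)
  have "\<bar>d * cos \<psi>\<bar> \<le> \<bar>d\<bar>"
    by (simp add: abs_mult mult_left_le)
  then have pos: "A + d * cos \<psi> > 0" using A by linarith
  define E where "E = A + S + d * cos \<psi>"
  have E: "E > 0" using pos S by (simp add: E_def)
  have cs: "(sin \<psi>)\<^sup>2 = 1 - (cos \<psi>)\<^sup>2" by (simp add: sin_squared_eq)
  have sum: "E\<^sup>2 + (d * sin \<psi>)\<^sup>2 = 2 * (A + S) * (A + d * cos \<psi>)"
    using S(2) cs unfolding E_def by algebra
  have num: "d * cos \<psi> * E + d * sin \<psi> * (d * sin \<psi>) = d * cos \<psi> * (A + S) + d\<^sup>2"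
    using cs unfolding E_def by algebra
  have "((\<lambda>\<psi>. \<psi> - 2 * arctan (d * sin \<psi> / (A + S + d * cos \<psi>)))
          has_real_derivative 1 - 2 * ((d * cos \<psi> * E + d * sin \<psi> * (d * sin \<psi>)) / E\<^sup>2 / (1 + (d * sin \<psi> / E)\<^sup>2))) (at \<psi>)"
    using E unfolding E_def
    by (auto intro!: derivative_eq_intros simp: power2_eq_square field_simps)
  also have "(d * cos \<psi> * E + d * sin \<psi> * (d * sin \<psi>)) / E\<^sup>2 / (1 + (d * sin \<psi> / E)\<^sup>2)
      = (d * cos \<psi> * (A + S) + d\<^sup>2) / (E\<^sup>2 + (d * sin \<psi>)\<^sup>2)"
  proof -
    have "1 + (d * sin \<psi> / E)\<^sup>2 = (E\<^sup>2 + (d * sin \<psi>)\<^sup>2) / E\<^sup>2"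
      using E by (simp add: field_simps)
    then show ?thesis unfolding num using E by simp
  qed
  also have "1 - 2 * \<dots> = S / (A + d * cos \<psi>)"
  proof -
    have "A + S > 0" using A S by linarith
    moreover have "(A + S) * (A + d * cos \<psi>) - (d * cos \<psi> * (A + S) + d\<^sup>2) = S * (A + S)"
      using S(2) by (simp add: power2_eq_square algebra_simps)
    ultimately show ?thesis
      unfolding sum using pos by (simp add: divide_simps) (simp add: algebra_simps)
  qed
  finally show ?thesis .
qed

section \<open>The profile function and its differential equations\<close>

locale delaunay_profile =
  fixes H C :: real
  assumes H_neg: "H < 0" and C_gt: "C > 2 * (H + sqrt (1 + H\<^sup>2))"
begin

text \<open>\<open>m\<close> and \<open>d\<close> are the mean and the amplitude of
  \<open>X\<close>, the square of g. \<open>v\<close> is a closed form of g', found as X' / (2 g),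
  and \<open>Q\<close> is the denominator g'^2 + g^2 in the integrand of \<theta>.\<close>

definition w :: real where "w = sqrt (1 + H\<^sup>2)"
definition m :: real where "m = (C - 2 * H) / (2 * w\<^sup>2)"
definition d :: real where "d = sqrt (C\<^sup>2 - 4 * C * H - 4) / (2 * w\<^sup>2)"
definition X :: "real \<Rightarrow> real" where "X t = m + d * sin (2 * w * t)"
definition v :: "real \<Rightarrow> real" where "v t = w * d * cos (2 * w * t) / g H C t"
definition Q :: "real \<Rightarrow> real" where "Q t = (v t)\<^sup>2 + X t"
definition b :: "real \<Rightarrow> real" where "b t = H * X t + 1"

abbreviation "\<theta> \<equiv> theta H C"
abbreviation "G \<equiv> g H C"

lemma w_gt_1: "w > 1"
  using H_neg by (simp add: w_def)

lemma w_sq: "w\<^sup>2 = 1 + H\<^sup>2"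
  by (simp add: w_def)

lemma w_gt_abs_H: "- H < w"
  by (rule power_less_imp_less_base[of _ 2]) (use w_sq w_gt_1 in auto)

lemma C_pos: "C > 0"
  using C_gt w_gt_abs_H by (simp add: w_def)

text \<open>The discriminant is (C - 2 H)^2 - (2 w)^2, and the hypothesis on \<open>C\<close> says
  that C - 2 H > 2 w.\<close>

lemma discr_pos: "C\<^sup>2 - 4 * C * H - 4 > 0"
proof -
  have "(2 * w)\<^sup>2 < (C - 2 * H)\<^sup>2"
    using C_gt w_gt_1 by (intro power_strict_mono) (auto simp: w_def)
  then show ?thesis using w_sq by (simp add: power2_eq_square algebra_simps)
qed

lemma d_pos: "d > 0"
  using discr_pos w_gt_1 by (simp add: d_def)

lemma m_pos: "m > 0"
  using C_pos H_neg w_gt_1 by (auto simp: m_def)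

lemma m_w: "2 * w\<^sup>2 * m = C - 2 * H"
  using w_gt_1 by (simp add: m_def)

text \<open>The squared numerators of \<open>m\<close> and \<open>d\<close> differ by 4 w^2. In
  other words, the extremal values m + d and m - d of \<open>X\<close> have product 1 / w^2.\<close>

lemma m_d: "w\<^sup>2 * (m\<^sup>2 - d\<^sup>2) = 1"
proof -
  have "(2 * w\<^sup>2 * m)\<^sup>2 - (2 * w\<^sup>2 * d)\<^sup>2 = 4 * w\<^sup>2"
  proof -
    have "2 * w\<^sup>2 * d = sqrt (C\<^sup>2 - 4 * C * H - 4)"
      using w_gt_1 by (simp add: d_def)
    then have "(2 * w\<^sup>2 * d)\<^sup>2 = C\<^sup>2 - 4 * C * H - 4"
      using discr_pos by simp
    then show ?thesis
      unfolding m_w using w_sq by algebra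
  qed
  then have "4 * w\<^sup>2 * (w\<^sup>2 * (m\<^sup>2 - d\<^sup>2)) = 4 * w\<^sup>2"
    by (simp add: power2_eq_square algebra_simps)
  then show ?thesis using w_gt_1 by simp
qed

lemma d_less_m: "d < m"
proof (rule power_less_imp_less_base[of _ 2])
  have "m\<^sup>2 - d\<^sup>2 > 0" using m_d w_gt_1 by (metis zero_less_mult_pos zero_less_one zero_less_power less_trans)
  then show "d\<^sup>2 < m\<^sup>2" by simp
qed (use m_pos in simp)

lemma X_pos: "X t > 0"
proof -
  have "d * sin (2 * w * t) \<ge> d * (-1)"
    using d_pos by (intro mult_left_mono) auto
  then show ?thesis using d_less_m by (simp add: X_def)
qed

lemma G_eq: "G t = sqrt (X t)"
proof -
  have "2 + 2 * H\<^sup>2 = 2 * w\<^sup>2" using w_sq by simp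
  then show ?thesis by (simp add: g_def X_def m_def d_def w_def)
qed

lemma G_pos: "G t > 0" using X_pos by (simp add: G_eq)

lemma G_sq: "(G t)\<^sup>2 = X t" using X_pos[of t] by (simp add: G_eq)

lemma X_deriv: "(X has_real_derivative 2 * w * d * cos (2 * w * t)) (at t)"
  unfolding X_def[abs_def] by (auto intro!: derivative_eq_intros)

lemma X_deriv': "(X has_real_derivative 2 * G t * v t) (at t)"
  using X_deriv[of t] G_pos[of t] by (simp add: v_def field_simps)

lemma G_deriv: "(G has_real_derivative v t) (at t)"
proof -
  have "G = (\<lambda>t. sqrt (X t))" using G_eq by auto
  moreover have "((\<lambda>t. sqrt (X t)) has_real_derivative v t) (at t)"
    using X_pos[of t]
    by (auto intro!: derivative_eq_intros X_deriv simp: v_def G_eq field_simps)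
  ultimately show ?thesis by simp
qed

lemma deriv_G: "deriv G t = v t"
  using G_deriv by (rule DERIV_imp_deriv)

text \<open>This is the first integral g'^2 + g^2 (1 + (H + g^{-2})^2) = C multiplied by
  g^2.\<close>

lemma v_sq: "X t * (v t)\<^sup>2 = (C - 2 * H) * X t - w\<^sup>2 * (X t)\<^sup>2 - 1"
proof -
  have "X t * (v t)\<^sup>2 = w\<^sup>2 * d\<^sup>2 * (1 - (sin (2 * w * t))\<^sup>2)"
    using X_pos[of t] by (simp add: v_def power_divide power_mult_distrib G_sq cos_squared_eq)
  also have "\<dots> = w\<^sup>2 * d\<^sup>2 - w\<^sup>2 * (X t - m)\<^sup>2"
    by (simp add: X_def power_mult_distrib algebra_simps)
  also have "\<dots> = 2 * w\<^sup>2 * m * X t - w\<^sup>2 * (X t)\<^sup>2 - w\<^sup>2 * (m\<^sup>2 - d\<^sup>2)"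
    by (simp add: power2_eq_square algebra_simps)
  finally show ?thesis by (simp add: m_d m_w)
qed

lemma Q_pos: "Q t > 0"
  using X_pos[of t] by (simp add: Q_def add_nonneg_pos)

text \<open>The first integral again, in the form X v^2 + X^2 + b^2 = C X.\<close>

lemma X_Q: "X t * Q t = C * X t - (b t)\<^sup>2"
  using v_sq[of t] w_sq unfolding Q_def b_def by algebra

lemma a_b_sq: "C * (v t)\<^sup>2 + (b t)\<^sup>2 = Q t * (C - X t)"
  using X_Q[of t] by (simp add: Q_def algebra_simps)

text \<open>Eliminating v^2 by the first integral turns the quotient rule into g'' = g^{-3} - w^2
  g.\<close>

lemma v_deriv: "(v has_real_derivative 1 / (G t * X t) - w\<^sup>2 * G t) (at t)"
proof -
  have eq: "(- 2 * w\<^sup>2 * (X t - m) - (v t)\<^sup>2) / G t = 1 / (G t * X t) - w\<^sup>2 * G t"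
  proof -
    have "X t * (- 2 * w\<^sup>2 * (X t - m) - (v t)\<^sup>2) = 1 - w\<^sup>2 * (X t)\<^sup>2"
      using v_sq[of t] m_w by algebra
    then have "(- 2 * w\<^sup>2 * (X t - m) - (v t)\<^sup>2) = (1 - w\<^sup>2 * (X t)\<^sup>2) / X t"
      using X_pos[of t] by (simp add: field_simps)
    then have "(- 2 * w\<^sup>2 * (X t - m) - (v t)\<^sup>2) / G t = 1 / (G t * X t) - w\<^sup>2 * X t / G t"
      using X_pos[of t] G_pos[of t] by (simp add: field_simps power2_eq_square)
    also have "w\<^sup>2 * X t / G t = w\<^sup>2 * G t"
      using G_pos[of t] by (simp add: G_sq[symmetric] power2_eq_square)
    finally show ?thesis .
  qed
  have "(v has_real_derivative (- 2 * w\<^sup>2 * (X t - m) - (v t)\<^sup>2) / G t) (at t)"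
    unfolding v_def[abs_def] using G_pos[of t]
    by (auto intro!: derivative_eq_intros G_deriv simp: X_def v_def power2_eq_square field_simps)
  then show ?thesis unfolding eq .
qed

lemma b_deriv: "(b has_real_derivative 2 * H * G t * v t) (at t)"
  unfolding b_def[abs_def] by (auto intro!: derivative_eq_intros X_deriv')

section \<open>The rotation angle and its reflection symmetries\<close>

definition \<theta>' :: "real \<Rightarrow> real" where
  "\<theta>' t = sqrt C * G t * (H - 1 / X t) / Q t"

lemma theta_deriv: "(\<theta> has_real_derivative \<theta>' t) (at t)"
proof -
  define c where "c = period H / 4"
  have "continuous_on S G" "continuous_on S X" "continuous_on S v" for S
    by (meson DERIV_continuous_on has_field_derivative_at_within G_deriv X_deriv v_deriv)+
  note [continuous_intros] = this
  have cont: "continuous_on S \<theta>'" for S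
    unfolding \<theta>'_def[abs_def] Q_def
    by (intro continuous_intros)
       (use X_pos Q_pos in \<open>auto simp: Q_def less_imp_neq[symmetric]\<close>)
  \<comment> \<open>The interval contains the base point T/4 and has \<open>t\<close> in its
    interior, on whichever side of T/4 it lies, so the derivative within the interval is the full
    derivative.\<close>
  define lo hi where "lo = min c t - 1" and "hi = max c t + 1"
  have "((\<lambda>u. LBINT y=c..u. \<theta>' y) has_vector_derivative \<theta>' t) (at t within {lo..hi})"
    by (rule interval_integral_FTC2) (auto simp: lo_def hi_def cont)
  moreover have "\<theta> = (\<lambda>u. LBINT y=c..u. \<theta>' y)"
    by (rule ext) (simp add: theta_def \<theta>'_def c_def deriv_G Q_def G_sq)
  ultimately have "(\<theta> has_real_derivative \<theta>' t) (at t within {lo..hi})"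
    by (simp add: has_real_derivative_iff_has_vector_derivative)
  moreover have "at t within {lo..hi} = at t"
    by (rule at_within_interior) (auto simp: lo_def hi_def)
  ultimately show ?thesis by simp
qed

lemma theta'_neg: "\<theta>' t < 0"
  unfolding \<theta>'_def using C_pos G_pos[of t] X_pos[of t] Q_pos[of t] H_neg
  by (intro divide_neg_pos mult_pos_neg mult_pos_pos) (auto intro: less_trans)

lemma theta_strict_antimono: "x < y \<Longrightarrow> \<theta> y < \<theta> x"
  by (rule DERIV_neg_imp_decreasing) (use theta_deriv theta'_neg in blast)+

text \<open>These are T/4, the base point of \<theta>, and 3T/4: a maximum of \<open>X\<close> and
  the minimum that follows it.\<close>

definition ts :: real where "ts = pi / (4 * w)"
definition te :: real where "te = 3 * ts"

lemma ts: "2 * w * ts = pi / 2" and te: "2 * w * te = 3 * pi / 2"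
  using w_gt_1 by (auto simp: ts_def te_def)

lemma ts_less_te: "ts < te"
  using w_gt_1 by (simp add: ts_def te_def divide_strict_right_mono)

lemma cos_3pi_half: "cos (3 * pi / 2) = 0" and sin_3pi_half: "sin (3 * pi / 2) = - 1"
  using cos_add[of pi "pi / 2"] sin_add[of pi "pi / 2"] by auto

lemma X_ts: "X ts = m + d" and X_te: "X te = m - d"
  by (simp_all add: X_def ts te sin_3pi_half)

lemma v_ts: "v ts = 0" and v_te: "v te = 0"
  by (simp_all add: v_def ts te cos_3pi_half)

lemma v_neg:
  assumes "ts < t" "t < te"
  shows "v t < 0"
proof -
  have "2 * w * ts < 2 * w * t" "2 * w * t < 2 * w * te"
    using assms w_gt_1 by auto
  then have "cos (2 * w * t - pi) > 0"
    unfolding ts te by (intro cos_gt_zero_pi) auto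
  then have "cos (2 * w * t) < 0" by (simp add: cos_diff)
  then show ?thesis
    using w_gt_1 d_pos G_pos[of t] by (auto simp: v_def intro!: divide_neg_pos mult_pos_neg)
qed

lemma theta_ts: "\<theta> ts = 0"
  by (simp add: theta_def ts_def period_def w_def mult.commute)

text \<open>The hypothesis makes \<open>c\<close> a critical point of \<open>X\<close>. About it
  \<open>X\<close> and \<open>\<theta>'\<close> are even and \<open>v\<close> is odd, so
  \<open>\<theta> (2 * c - t) + \<theta> t\<close> is constant in \<open>t\<close>.\<close>

lemma reflect:
  assumes "cos (2 * w * c) = 0"
  shows "X (2 * c - t) = X t" "v (2 * c - t) = - v t" "\<theta> (2 * c - t) = 2 * \<theta> c - \<theta> t"
proof -
  have arg: "2 * w * (2 * c - s) = 2 * (2 * w * c) - 2 * w * s" for s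
    by (simp add: algebra_simps)
  have sin: "sin (2 * w * (2 * c - s)) = sin (2 * w * s)"
    and cos: "cos (2 * w * (2 * c - s)) = - cos (2 * w * s)" for s
    unfolding arg sin_diff cos_diff sin_double cos_double using assms
    by (simp_all add: sin_squared_eq)
  show X: "X (2 * c - s) = X s" for s by (simp only: X_def sin)
  then show v: "v (2 * c - s) = - v s" for s by (simp only: v_def cos G_eq)
  have \<theta>': "\<theta>' (2 * c - s) = \<theta>' s" for s
    by (simp add: \<theta>'_def Q_def X v G_eq)
  have "((\<lambda>s. \<theta> (2 * c - s) + \<theta> s) has_real_derivative 0) (at s)" for s
    by (auto intro!: derivative_eq_intros DERIV_chain2[OF theta_deriv] theta_deriv simp: \<theta>')
  then have "\<theta> (2 * c - t) + \<theta> t = \<theta> (2 * c - c) + \<theta> c"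
    using DERIV_isconst_all[of "\<lambda>s. \<theta> (2 * c - s) + \<theta> s" t c] by blast
  then show "\<theta> (2 * c - t) = 2 * \<theta> c - \<theta> t"
    by simp
qed

lemma cos_c_ts: "cos (2 * w * ts) = 0" and cos_c_te: "cos (2 * w * te) = 0"
  and cos_c_minus_ts: "cos (2 * w * (- ts)) = 0"
  by (simp_all add: ts te cos_3pi_half)

text \<open>As \<open>- ts\<close> is the minimum of \<open>X\<close> that precedes
  \<open>ts\<close>, the rotation over one full period from there to \<open>te\<close> is
  \<open>2 * \<theta> te\<close>.\<close>

lemma theta_minus_ts: "\<theta> (- ts) = - \<theta> te"
  using reflect(3)[OF cos_c_ts, of te] by (simp add: theta_ts te_def)

section \<open>Bounds for the rotation over half a period\<close>

text \<open>With s = sqrt C, the polynomial C x^2 - (H x^2 + 1)^2 factors as (s x - H x^2 - 1) (s x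
  + H x^2 + 1), and \<open>u1\<close> and \<open>u2\<close> are the positive zeros of the first and
  the second factor.\<close>

lemma obtain_roots:
  obtains u1 u2 where "0 < u1" "u1 < u2" "- H * u1 * u2 = 1" "- H * (u2 - u1) = sqrt C"
    "C - 2 * H = H\<^sup>2 * (u1\<^sup>2 + u2\<^sup>2)" "H\<^sup>2 * u1\<^sup>2 * u2\<^sup>2 = 1"
    "\<forall>t. X t * Q t = H\<^sup>2 * (X t - u1\<^sup>2) * (u2\<^sup>2 - X t)"
    "\<forall>t. u1\<^sup>2 < X t" "\<forall>t. X t < u2\<^sup>2"
proof -
  define R s where "R = sqrt (C - 4 * H)" and "s = sqrt C"
  have s: "s > 0" "s\<^sup>2 = C" and R: "s < R" "R\<^sup>2 = C - 4 * H"
    using C_pos H_neg by (auto simp: s_def R_def)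
  define u1 u2 where "u1 = (R - s) / (- 2 * H)" and "u2 = (R + s) / (- 2 * H)"
  have u: "0 < u1" "u1 < u2"
    unfolding u1_def u2_def using H_neg R(1) s(1)
    by (auto intro!: divide_pos_pos divide_strict_right_mono simp del: divide_minus_left minus_divide_right[symmetric] mult_minus_left)
  have prod: "- H * u1 * u2 = 1"
  proof -
    have "- H * u1 * u2 = (R\<^sup>2 - s\<^sup>2) / (- 4 * H)"
      using H_neg by (simp add: u1_def u2_def field_simps power2_eq_square)
    then show ?thesis using H_neg by (simp add: R(2) s(2))
  qed
  have diff: "- H * (u2 - u1) = s"
    using H_neg by (simp add: u1_def u2_def field_simps)
  have sum2: "C - 2 * H = H\<^sup>2 * (u1\<^sup>2 + u2\<^sup>2)"
    using prod diff s(2) by algebra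
  have prod2: "H\<^sup>2 * u1\<^sup>2 * u2\<^sup>2 = 1"
    using prod by algebra
  have XQ: "X t * Q t = H\<^sup>2 * (X t - u1\<^sup>2) * (u2\<^sup>2 - X t)" for t
    using X_Q[of t] sum2 prod2 unfolding b_def by algebra
  have "H\<^sup>2 * (X t - u1\<^sup>2) * (u2\<^sup>2 - X t) > 0" for t
    using X_pos[of t] Q_pos[of t] by (simp flip: XQ)
  then have pos: "(X t - u1\<^sup>2) * (u2\<^sup>2 - X t) > 0" for t
    using H_neg by (simp add: mult.assoc zero_less_mult_iff)
  have "u1\<^sup>2 < u2\<^sup>2" using u by (intro power_strict_mono) auto
  with pos have "u1\<^sup>2 < X t" "X t < u2\<^sup>2" for t
    by (smt (verit) zero_less_mult_iff)+
  with that u prod diff sum2 prod2 XQ show thesis unfolding s_def by blast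
qed

text \<open>The substitution \<psi> = 2 w t - pi / 2 maps [ts, te] to [0, pi], at whose ends the
  arctangent vanishes; hence the increment pi does not depend on \<open>A\<close> and
  \<open>k\<close>.\<close>

lemma obtain_antiderivative:
  assumes "\<bar>k\<bar> < A"
  obtains L where "L ts = 0" "L te = pi"
    "\<And>t. (L has_real_derivative 2 * w * sqrt (A\<^sup>2 - k\<^sup>2) / (A + k * sin (2 * w * t))) (at t)"
proof
  define S where "S = sqrt (A\<^sup>2 - k\<^sup>2)"
  define T where "T = (\<lambda>\<psi>. \<psi> - 2 * arctan (k * sin \<psi> / (A + S + k * cos \<psi>)))"
  define L where "L = (\<lambda>t. T (2 * w * t - pi / 2))"
  show "L ts = 0" "L te = pi"
    by (simp_all add: L_def T_def ts te)
  fix t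
  have "cos (2 * w * t - pi / 2) = sin (2 * w * t)"
    by (simp add: cos_diff)
  moreover have "(T has_real_derivative S / (A + k * cos \<psi>)) (at \<psi>)" for \<psi>
    unfolding T_def S_def using assms by (rule has_real_derivative_psi_minus_arctan)
  ultimately have "(T has_real_derivative S / (A + k * sin (2 * w * t))) (at (2 * w * t - pi / 2))"
    by metis
  moreover have "((\<lambda>t. 2 * w * t - pi / 2) has_real_derivative 2 * w) (at t)"
    by (auto intro!: derivative_eq_intros)
  ultimately have "(L has_real_derivative S / (A + k * sin (2 * w * t)) * (2 * w)) (at t)"
    unfolding L_def by (rule DERIV_chain2)
  then show "(L has_real_derivative 2 * w * sqrt (A\<^sup>2 - k\<^sup>2) / (A + k * sin (2 * w * t))) (at t)"
    by (simp add: S_def mult.commute)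
qed

lemma theta_te_bounds: "- pi < \<theta> te" "\<theta> te < - pi / 2"
proof -
  obtain u1 u2 where u: "0 < u1" "u1 < u2" "- H * u1 * u2 = 1" "- H * (u2 - u1) = sqrt C"
    and e: "C - 2 * H = H\<^sup>2 * (u1\<^sup>2 + u2\<^sup>2)" "H\<^sup>2 * u1\<^sup>2 * u2\<^sup>2 = 1"
    and roots: "\<forall>t. X t * Q t = H\<^sup>2 * (X t - u1\<^sup>2) * (u2\<^sup>2 - X t)"
      "\<forall>t. u1\<^sup>2 < X t" "\<forall>t. X t < u2\<^sup>2"
    by (rule obtain_roots)
  note XQ = roots(1)[rule_format] and X = roots(2)[rule_format] roots(3)[rule_format]
  have u2: "u2 > 0" using u by linarith
  have \<theta>': "\<theta>' t = - (u1 * G t / (X t - u1\<^sup>2) + u2 * G t / (u2\<^sup>2 - X t))" for t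
  proof -
    have "\<theta>' t = sqrt C * G t * (H * X t - 1) / (X t * Q t)"
      using X_pos[of t] Q_pos[of t] by (simp add: \<theta>'_def field_simps)
    also have "\<dots> = sqrt C * G t * (H * X t - 1) / (H\<^sup>2 * (X t - u1\<^sup>2) * (u2\<^sup>2 - X t))"
      by (simp only: XQ)
    \<comment> \<open>Partial fractions: both sides equal - H^2 g (u2 - u1) (X + u1 u2).\<close>
    also have "sqrt C * G t * (H * X t - 1)
        = - (H\<^sup>2) * (u1 * G t * (u2\<^sup>2 - X t) + u2 * G t * (X t - u1\<^sup>2))"
      using u(3,4) by algebra
    also have "\<dots> / (H\<^sup>2 * (X t - u1\<^sup>2) * (u2\<^sup>2 - X t))
        = - (u1 * G t / (X t - u1\<^sup>2) + u2 * G t / (u2\<^sup>2 - X t))"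
      using X[of t] H_neg by (simp add: divide_simps)
    finally show ?thesis .
  qed
  \<comment> \<open>In general w^2 ((m - x)^2 - d^2) = w^2 x^2 - (C - 2 H) x + 1. At the roots x =
    u1^2 and x = u2^2 one has (C - 2 H) x = H^2 x^2 + 1, which leaves x^2.\<close>
  have S1: "(m - u1\<^sup>2)\<^sup>2 - d\<^sup>2 = (u1\<^sup>2 / w)\<^sup>2" and S2: "(u2\<^sup>2 - m)\<^sup>2 - (- d)\<^sup>2 = (u2\<^sup>2 / w)\<^sup>2"
  proof -
    have "w\<^sup>2 * ((m - u1\<^sup>2)\<^sup>2 - d\<^sup>2) = (u1\<^sup>2)\<^sup>2" "w\<^sup>2 * ((u2\<^sup>2 - m)\<^sup>2 - (- d)\<^sup>2) = (u2\<^sup>2)\<^sup>2"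
      using m_w m_d w_sq e by algebra+
    then show "(m - u1\<^sup>2)\<^sup>2 - d\<^sup>2 = (u1\<^sup>2 / w)\<^sup>2" "(u2\<^sup>2 - m)\<^sup>2 - (- d)\<^sup>2 = (u2\<^sup>2 / w)\<^sup>2"
      using w_gt_1 by (simp_all add: power_divide field_simps)
  qed
  have "\<bar>d\<bar> < m - u1\<^sup>2"
    using X(1)[of te] d_pos by (simp add: X_te)
  from obtain_antiderivative[OF this]
  obtain L1 where L1: "L1 ts = 0" "L1 te = pi"
    "(L1 has_real_derivative 2 * w * sqrt ((m - u1\<^sup>2)\<^sup>2 - d\<^sup>2) / (m - u1\<^sup>2 + d * sin (2 * w * t))) (at t)" for t
    by blast
  have dL1: "((\<lambda>t. L1 t / 2) has_real_derivative u1\<^sup>2 / (X t - u1\<^sup>2)) (at t)" for t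
  proof (rule DERIV_cong[OF DERIV_cdivide[OF L1(3)]])
    have eq: "m - u1\<^sup>2 + d * sin (2 * w * t) = X t - u1\<^sup>2" by (simp add: X_def)
    show "2 * w * sqrt ((m - u1\<^sup>2)\<^sup>2 - d\<^sup>2) / (m - u1\<^sup>2 + d * sin (2 * w * t)) / 2 = u1\<^sup>2 / (X t - u1\<^sup>2)"
    proof -
      have "2 * w * sqrt ((u1\<^sup>2 / w)\<^sup>2) = 2 * u1\<^sup>2"
        using w_gt_1 by simp
      moreover have "2 * x / y / 2 = x / y" for x y :: real by simp
      ultimately show ?thesis unfolding S1 eq by metis
    qed
  qed
  have "\<bar>- d\<bar> < u2\<^sup>2 - m"
    using X(2)[of ts] d_pos by (simp add: X_ts)
  from obtain_antiderivative[OF this]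
  obtain L2 where L2: "L2 ts = 0" "L2 te = pi"
    "(L2 has_real_derivative 2 * w * sqrt ((u2\<^sup>2 - m)\<^sup>2 - (- d)\<^sup>2) / (u2\<^sup>2 - m + - d * sin (2 * w * t))) (at t)" for t
    by blast
  have dL2: "((\<lambda>t. L2 t / 2) has_real_derivative u2\<^sup>2 / (u2\<^sup>2 - X t)) (at t)" for t
  proof (rule DERIV_cong[OF DERIV_cdivide[OF L2(3)]])
    have eq: "u2\<^sup>2 - m + - d * sin (2 * w * t) = u2\<^sup>2 - X t" by (simp add: X_def)
    show "2 * w * sqrt ((u2\<^sup>2 - m)\<^sup>2 - (- d)\<^sup>2) / (u2\<^sup>2 - m + - d * sin (2 * w * t)) / 2 = u2\<^sup>2 / (u2\<^sup>2 - X t)"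
    proof -
      have "2 * w * sqrt ((u2\<^sup>2 / w)\<^sup>2) = 2 * u2\<^sup>2"
        using w_gt_1 by simp
      moreover have "2 * x / y / 2 = x / y" for x y :: real by simp
      ultimately show ?thesis unfolding S2 eq by metis
    qed
  qed

  \<comment> \<open>In - \<theta>' the second fraction is dropped and g is replaced by
    \<open>u1\<close> in the first; what remains has integral pi / 2.\<close>
  have "\<theta> te + L1 te / 2 < \<theta> ts + L1 ts / 2"
  proof (rule DERIV_neg_imp_decreasing[where f = "\<lambda>t. \<theta> t + L1 t / 2", OF ts_less_te])
    fix t
    have "u1 < G t"
      by (rule power_less_imp_less_base[of _ 2]) (use X(1)[of t] G_pos[of t] in \<open>auto simp: G_sq\<close>)
    then have "u1\<^sup>2 / (X t - u1\<^sup>2) < u1 * G t / (X t - u1\<^sup>2)"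
      using u(1) X(1)[of t] by (intro divide_strict_right_mono) (auto simp: power2_eq_square)
    moreover have "u2 * G t / (u2\<^sup>2 - X t) > 0"
      using u2 G_pos[of t] X(2)[of t] by simp
    ultimately have "\<theta>' t + u1\<^sup>2 / (X t - u1\<^sup>2) < 0"
      by (simp add: \<theta>')
    moreover have "((\<lambda>t. \<theta> t + L1 t / 2) has_real_derivative \<theta>' t + u1\<^sup>2 / (X t - u1\<^sup>2)) (at t)"
      by (intro DERIV_add theta_deriv dL1)
    ultimately show "\<exists>y. ((\<lambda>t. \<theta> t + L1 t / 2) has_real_derivative y) (at t) \<and> y < 0"
      by blast
  qed
  then show "\<theta> te < - pi / 2"
    by (simp add: theta_ts L1)

  \<comment> \<open>AM-GM with weights p and q bounds the two integrals by (pi / 4) (1 + 1 / w +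
    p^2) / p and (pi / 4) (1 - 1 / w + q^2) / q. These weights minimise the two bounds.\<close>
  define p q where "p = sqrt (1 + 1 / w)" and "q = sqrt (1 - 1 / w)"
  have p: "p > 0" "p\<^sup>2 = 1 + 1 / w" and q: "q > 0" "q\<^sup>2 = 1 - 1 / w"
    using w_gt_1 by (auto simp: p_def q_def add_pos_pos)
  define M where "M = (\<lambda>t. ((t - ts) + (1 + p\<^sup>2) * (L1 t / 2)) / (2 * p) +
     (- (t - ts) + (1 + q\<^sup>2) * (L2 t / 2)) / (2 * q))"
  have amgm: "c * G t \<le> (X t + c\<^sup>2 * r\<^sup>2) / (2 * r)" if "r > 0" for c r t
  proof -
    have "0 \<le> (G t - c * r)\<^sup>2" by simp
    then show ?thesis using that by (simp add: power2_diff G_sq power_mult_distrib field_simps)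
  qed
  have "\<theta> ts + M ts \<le> \<theta> te + M te"
  proof (rule DERIV_nonneg_imp_nondecreasing[where f = "\<lambda>t. \<theta> t + M t"])
    fix t
    have "u1 * G t / (X t - u1\<^sup>2) \<le> (X t + u1\<^sup>2 * p\<^sup>2) / (2 * p) / (X t - u1\<^sup>2)"
      using X(1)[of t] p by (intro divide_right_mono amgm) auto
    also have "\<dots> = (1 + (1 + p\<^sup>2) * (u1\<^sup>2 / (X t - u1\<^sup>2))) / (2 * p)"
      using X(1)[of t] p(1) by (simp add: divide_simps) (simp add: algebra_simps)
    finally have 1: "u1 * G t / (X t - u1\<^sup>2) \<le> \<dots>" .
    have "u2 * G t / (u2\<^sup>2 - X t) \<le> (X t + u2\<^sup>2 * q\<^sup>2) / (2 * q) / (u2\<^sup>2 - X t)"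
      using X(2)[of t] q by (intro divide_right_mono amgm) auto
    also have "\<dots> = (- 1 + (1 + q\<^sup>2) * (u2\<^sup>2 / (u2\<^sup>2 - X t))) / (2 * q)"
      using X(2)[of t] q(1) by (simp add: divide_simps) (simp add: algebra_simps)
    finally have 2: "u2 * G t / (u2\<^sup>2 - X t) \<le> \<dots>" .
    define M' where "M' = (1 + (1 + p\<^sup>2) * (u1\<^sup>2 / (X t - u1\<^sup>2))) / (2 * p) +
      (- 1 + (1 + q\<^sup>2) * (u2\<^sup>2 / (u2\<^sup>2 - X t))) / (2 * q)"
    have "((\<lambda>t. \<theta> t + M t) has_real_derivative \<theta>' t + M') (at t)"
      unfolding M_def M'_def
      by (intro DERIV_add DERIV_cdivide DERIV_cmult theta_deriv dL1 dL2)
         (auto intro!: derivative_eq_intros)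
    moreover have "0 \<le> \<theta>' t + M'"
      using 1 2 by (simp add: \<theta>' M'_def)
    ultimately show "\<exists>y. ((\<lambda>t. \<theta> t + M t) has_real_derivative y) (at t) \<and> 0 \<le> y"
      by blast
  qed (use ts_less_te in simp)
  moreover have "M ts = 0" by (simp add: M_def L1 L2)
  moreover have "M te = pi / 2 * (p + q)"
  proof -
    have "te - ts = pi / 2 * (1 / w)" using w_gt_1 by (simp add: te_def ts_def)
    then have "(te - ts) + (1 + p\<^sup>2) * (pi / 2) = pi * p\<^sup>2" "- (te - ts) + (1 + q\<^sup>2) * (pi / 2) = pi * q\<^sup>2"
      using p(2) q(2) by algebra+
    then have "M te = pi * p\<^sup>2 / (2 * p) + pi * q\<^sup>2 / (2 * q)"
      by (simp only: M_def L1 L2)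
    then show ?thesis
      using p(1) q(1) by (simp add: power2_eq_square distrib_left)
  qed
  moreover have "p + q < 2"
  proof (rule power_less_imp_less_base[of _ 2])
    have "p \<noteq> q" using p(2) q(2) w_gt_1 by auto
    then have "(p - q)\<^sup>2 > 0" by simp
    moreover have "p\<^sup>2 + q\<^sup>2 = 2" using p(2) q(2) by simp
    ultimately show "(p + q)\<^sup>2 < 2\<^sup>2" by (simp add: power2_eq_square algebra_simps)
  qed simp
  then have "pi / 2 * (p + q) < pi / 2 * 2"
    by (intro mult_strict_left_mono) auto
  ultimately show "- pi < \<theta> te"
    using theta_ts by linarith
qed

section \<open>Angular momentum of \<beta> and transversal self-crossings\<close>

text \<open>With a = sqrt C v, the left side is a b' - a' b - (a^2 + b^2) \<theta>', the angular
  momentum of \<beta> before normalisation.\<close>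

lemma cross_identity:
  "sqrt C * v t * (2 * H * G t * v t) - sqrt C * (1 / (G t * X t) - w\<^sup>2 * G t) * b t
     - Q t * (C - X t) * \<theta>' t = sqrt C * Q t * b t / G t"
proof -
  define E where "E = 2 * H * (G t * (v t)\<^sup>2) - (1 / (G t * X t) - w\<^sup>2 * G t) * b t
     - (C - X t) * (G t * (H - 1 / X t))"
  have pos: "G t > 0" "X t > 0" "Q t > 0" using G_pos X_pos Q_pos by auto
  \<comment> \<open>Multiplying by g X clears the denominators and leaves a polynomial in X and
    v^2.\<close>
  have "X t * (G t * E) = 2 * H * X t * (X t * (v t)\<^sup>2) - (1 - w\<^sup>2 * (X t)\<^sup>2) * b t - (C - X t) * X t * (H * X t - 1)"
  proof -
    have "G t * E = 2 * H * ((G t)\<^sup>2 * (v t)\<^sup>2) - (1 / X t - w\<^sup>2 * (G t)\<^sup>2) * b t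
        - (C - X t) * ((G t)\<^sup>2 * (H - 1 / X t))"
    proof -
      have "G t * (1 / (G t * X t)) = 1 / X t" using pos by simp
      then show ?thesis unfolding E_def by algebra
    qed
    moreover have "X t * (1 / X t) = 1" using pos by simp
    ultimately show ?thesis unfolding G_sq by algebra
  qed
  also have "\<dots> = X t * (Q t * b t)"
    using v_sq[of t] w_sq unfolding Q_def b_def by algebra
  finally have "G t * E = Q t * b t" using pos by simp
  then have E: "E = Q t * b t / G t" using pos by (simp add: field_simps)
  have "Q t * (C - X t) * \<theta>' t = sqrt C * ((C - X t) * (G t * (H - 1 / X t)))"
    using pos by (simp add: \<theta>'_def)
  then have "sqrt C * v t * (2 * H * G t * v t) - sqrt C * (1 / (G t * X t) - w\<^sup>2 * G t) * b t
     - Q t * (C - X t) * \<theta>' t = sqrt C * E"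
    by (simp add: E_def power2_eq_square algebra_simps)
  then show ?thesis by (simp add: E)
qed

text \<open>\<open>N\<close> is the normalising factor of \<beta>, and (y1, y2) is the vector (sqrt
  C v, b) rotated by the angle pi - \<theta>.\<close>

definition N :: "real \<Rightarrow> real" where "N t = 1 / sqrt (C * Q t)"
definition y1 :: "real \<Rightarrow> real" where
  "y1 t = - sqrt C * v t * cos (\<theta> t) - b t * sin (\<theta> t)"
definition y2 :: "real \<Rightarrow> real" where
  "y2 t = sqrt C * v t * sin (\<theta> t) - b t * cos (\<theta> t)"

lemma beta_eq: "beta H C t $ 1 = N t * y1 t" "beta H C t $ 2 = N t * y2 t"
  by (simp_all add: beta_def N_def y1_def y2_def b_def Q_def deriv_G G_sq distrib_left)

lemma N_sq: "(N t)\<^sup>2 = 1 / (C * Q t)"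
  using C_pos Q_pos[of t] by (simp add: N_def power_divide)

lemma y_sq: "(y1 t)\<^sup>2 + (y2 t)\<^sup>2 = Q t * (C - X t)"
proof -
  have "(- A * c - B * s)\<^sup>2 + (A * s - B * c)\<^sup>2 = (A\<^sup>2 + B\<^sup>2) * (s\<^sup>2 + c\<^sup>2)" for A B s c :: real
    by (simp add: power2_eq_square algebra_simps)
  from this[of "sqrt C * v t" "cos (\<theta> t)" "b t" "sin (\<theta> t)"]
  have "(y1 t)\<^sup>2 + (y2 t)\<^sup>2 = (sqrt C * v t)\<^sup>2 + (b t)\<^sup>2"
    by (simp add: y1_def y2_def)
  then show ?thesis using C_pos by (simp add: power_mult_distrib a_b_sq)
qed

lemma norm_beta: "sqrt (1 - (norm (beta H C t))\<^sup>2) = G t / sqrt C"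
proof -
  have "(norm (beta H C t))\<^sup>2 = (N t)\<^sup>2 * ((y1 t)\<^sup>2 + (y2 t)\<^sup>2)"
    by (simp add: power2_norm_eq_inner inner_vec_def sum_2 beta_eq) (simp add: algebra_simps power2_eq_square)
  also have "\<dots> = 1 - X t / C"
    using C_pos Q_pos[of t] by (simp add: N_sq y_sq field_simps)
  finally show ?thesis by (simp add: real_sqrt_divide G_eq)
qed

lemma phi_eq: "phi H C (s, t) = vector
    [G t / sqrt C * cos s, G t / sqrt C * sin s, beta H C t $ 1, beta H C t $ 2]"
  by (simp add: phi_def norm_beta)

lemma beta_deriv:
  obtains p1 p2 where
    "((\<lambda>t. beta H C t $ 1) has_real_derivative p1) (at t)"
    "((\<lambda>t. beta H C t $ 2) has_real_derivative p2) (at t)"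
    "beta H C t $ 1 * p2 - beta H C t $ 2 * p1 = b t / (sqrt C * G t)"
proof -
  define q where "q = 2 * v t * (1 / (G t * X t) - w\<^sup>2 * G t) + 2 * G t * v t"
  have "(Q has_real_derivative q) (at t)"
    unfolding Q_def[abs_def] q_def
    by (auto intro!: derivative_eq_intros v_deriv X_deriv')
  moreover have CQ: "C * Q t > 0" using C_pos Q_pos[of t] by simp
  ultimately have "(N has_real_derivative - (C * q / (2 * sqrt (C * Q t))) / (C * Q t)) (at t)"
    unfolding N_def[abs_def]
    by (auto intro!: derivative_eq_intros simp: field_simps)
  \<comment> \<open>The value of \<open>n\<close> cancels in the cross product, which therefore only
    picks up the factor N^2.\<close>
  then obtain n where N: "(N has_real_derivative n) (at t)" by blast
  define a' where "a' = sqrt C * (1 / (G t * X t) - w\<^sup>2 * G t)"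
  define b' where "b' = 2 * H * G t * v t"
  define z1 where "z1 = - (a' * cos (\<theta> t)) + sqrt C * v t * sin (\<theta> t) * \<theta>' t
    - b' * sin (\<theta> t) - b t * cos (\<theta> t) * \<theta>' t"
  define z2 where "z2 = a' * sin (\<theta> t) + sqrt C * v t * cos (\<theta> t) * \<theta>' t
    - b' * cos (\<theta> t) + b t * sin (\<theta> t) * \<theta>' t"
  have y: "(y1 has_real_derivative z1) (at t)" "(y2 has_real_derivative z2) (at t)"
    unfolding y1_def[abs_def] y2_def[abs_def] z1_def z2_def a'_def b'_def
    by (auto intro!: derivative_eq_intros v_deriv b_deriv theta_deriv simp: algebra_simps)
  \<comment> \<open>A rotation preserves A b' - a' B, and the motion of its angle pi - \<theta>
    contributes the last term.\<close>
  have "(- A * c - B * s) * (a' * s + A * c * T - b' * c + B * s * T)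
      - (A * s - B * c) * (- (a' * c) + A * s * T - b' * s - B * c * T)
      = (A * b' - a' * B - (A\<^sup>2 + B\<^sup>2) * T) * (s\<^sup>2 + c\<^sup>2)" for A B T s c :: real
    by (simp add: power2_eq_square algebra_simps)
  from this[of "sqrt C * v t" "cos (\<theta> t)" "b t" "sin (\<theta> t)" "\<theta>' t"]
  have "y1 t * z2 - y2 t * z1
      = sqrt C * v t * b' - a' * b t - ((sqrt C * v t)\<^sup>2 + (b t)\<^sup>2) * \<theta>' t"
    by (simp add: y1_def y2_def z1_def z2_def)
  also have "\<dots> = sqrt C * Q t * b t / G t"
    using cross_identity[of t] C_pos by (simp add: a'_def b'_def power_mult_distrib a_b_sq)
  finally have y_cross: "y1 t * z2 - y2 t * z1 = sqrt C * Q t * b t / G t" .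
  have "N t * y1 t * (n * y2 t + z2 * N t) - N t * y2 t * (n * y1 t + z1 * N t)
      = (N t)\<^sup>2 * (y1 t * z2 - y2 t * z1)"
    by (simp add: power2_eq_square algebra_simps)
  also have "\<dots> = sqrt C * b t / (C * G t)"
    using Q_pos[of t] by (simp add: y_cross N_sq)
  also have "\<dots> = b t / (sqrt C * G t)"
  proof -
    have "sqrt C * b t / (sqrt C * (sqrt C * G t)) = b t / (sqrt C * G t)"
      using C_pos by simp
    then show ?thesis using C_pos by (simp flip: mult.assoc)
  qed
  finally show thesis
    using that DERIV_mult[OF N y(1)] DERIV_mult[OF N y(2)] by (simp add: beta_eq)
qed

lemma phi_curve_deriv:
  assumes "((\<lambda>t. beta H C t $ 1) has_real_derivative p1) (at t)"
    and "((\<lambda>t. beta H C t $ 2) has_real_derivative p2) (at t)"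
  shows "((\<lambda>\<tau>. phi H C (0, \<tau> + t)) has_vector_derivative vector [v t / sqrt C, 0, p1, p2]) (at 0)"
proof (rule has_vector_derivative_vec)
  have "(f has_real_derivative D) (at t) \<Longrightarrow> ((\<lambda>\<tau>. f (\<tau> + t)) has_real_derivative D) (at 0)" for f D
    using DERIV_shift[of f D 0 t] by simp
  note shift = this[OF assms(1)] this[OF assms(2)] this[OF DERIV_cdivide[OF G_deriv]]
  have "\<forall>i. ((\<lambda>\<tau>. phi H C (0, \<tau> + t) $ i) has_real_derivative
      vector [v t / sqrt C, 0, p1, p2] $ i) (at 0)"
    unfolding forall_4 using shift by (simp add: phi_eq vector_4)
  then show "((\<lambda>\<tau>. phi H C (0, \<tau> + t) $ i) has_real_derivative
      vector [v t / sqrt C, 0, p1, p2] $ i) (at 0)" for i by blast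
qed

lemma phi_circle_deriv:
  "((\<lambda>\<tau>. phi H C (\<tau>, t)) has_vector_derivative vector [0, G t / sqrt C, 0, 0]) (at 0)"
proof (rule has_vector_derivative_vec)
  have "\<forall>i. ((\<lambda>\<tau>. phi H C (\<tau>, t) $ i) has_real_derivative
      vector [0, G t / sqrt C, 0, 0] $ i) (at 0)"
    unfolding forall_4
    using DERIV_cmult[OF DERIV_cos[of 0], of "G t / sqrt C"]
      DERIV_cmult[OF DERIV_sin[of 0], of "G t / sqrt C"]
    by (simp add: phi_eq vector_4)
  then show "((\<lambda>\<tau>. phi H C (\<tau>, t) $ i) has_real_derivative
      vector [0, G t / sqrt C, 0, 0] $ i) (at 0)" for i by blast
qed

text \<open>
  The equation says that \<open>\<beta>(t)\<close> lies on the axis of the reflection that maps \<open>\<beta>(t)\<close> to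
  \<open>\<beta>(2 c - t)\<close>.
\<close>
lemma not_embedded_if_crossing:
  assumes c: "cos (2 * w * c) = 0"
    and F: "sqrt C * v t * cos (\<theta> t - \<theta> c) + b t * sin (\<theta> t - \<theta> c) = 0"
    and v: "v t \<noteq> 0" and b: "b t \<noteq> 0"
  shows "\<not> Sigma_embedded H C"
proof
  assume emb: "Sigma_embedded H C"
  define t' where "t' = 2 * c - t"
  have X': "X t' = X t" and v': "v t' = - v t" and \<theta>': "\<theta> t' = 2 * \<theta> c - \<theta> t"
    using reflect[OF c, of t] by (simp_all add: t'_def)
  have b': "b t' = b t" and G': "G t' = G t" and N': "N t' = N t"
    by (simp_all add: b_def X' G_eq N_def Q_def v')
  have "y1 t' = y1 t" "y2 t' = y2 t"
  proof -
    define \<kappa> \<delta> where "\<kappa> = \<theta> c" and "\<delta> = \<theta> t - \<theta> c"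
    have ang: "\<theta> t = \<kappa> + \<delta>" "\<theta> t' = \<kappa> - \<delta>" by (simp_all add: \<theta>' \<kappa>_def \<delta>_def)
    have F': "sqrt C * v t * cos \<delta> + b t * sin \<delta> = 0" using F by (simp add: \<delta>_def)
    \<comment> \<open>Both differences are multiples of the left side of \<open>F\<close>, so the
      two points of \<beta> coincide.\<close>
    have "y1 t' - y1 t = 2 * cos \<kappa> * (sqrt C * v t * cos \<delta> + b t * sin \<delta>)"
      "y2 t' - y2 t = - 2 * sin \<kappa> * (sqrt C * v t * cos \<delta> + b t * sin \<delta>)"
      by (simp_all add: y1_def y2_def ang b' v' sin_add sin_diff cos_add cos_diff algebra_simps)
    then show "y1 t' = y1 t" "y2 t' = y2 t"
      by (simp_all add: F')
  qed
  then have \<beta>': "beta H C t' $ 1 = beta H C t $ 1" "beta H C t' $ 2 = beta H C t $ 2"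
    by (simp_all add: beta_eq N')
  obtain p1 p2 where p: "((\<lambda>t. beta H C t $ 1) has_real_derivative p1) (at t)"
    "((\<lambda>t. beta H C t $ 2) has_real_derivative p2) (at t)"
    "beta H C t $ 1 * p2 - beta H C t $ 2 * p1 = b t / (sqrt C * G t)"
    by (rule beta_deriv)
  obtain q1 q2 where q: "((\<lambda>t. beta H C t $ 1) has_real_derivative q1) (at t')"
    "((\<lambda>t. beta H C t $ 2) has_real_derivative q2) (at t')"
    "beta H C t $ 1 * q2 - beta H C t $ 2 * q1 = b t / (sqrt C * G t)"
    using beta_deriv[of t'] unfolding \<beta>' b' G' by blast
  define v1 :: "real^4" where "v1 = vector [v t / sqrt C, 0, p1, p2]"
  define v2 :: "real^4" where "v2 = vector [v t' / sqrt C, 0, q1, q2]"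
  define v3 :: "real^4" where "v3 = vector [0, G t / sqrt C, 0, 0]"
  have c1: "v1 $ 1 \<noteq> 0" "v2 $ 1 = - v1 $ 1" "v3 $ 1 = 0"
    using v C_pos by (simp_all add: v1_def v2_def v3_def vector_4 v')
  have c2: "v1 $ 2 = 0" "v2 $ 2 = 0" "v3 $ 2 \<noteq> 0"
    using C_pos G_pos[of t] by (simp_all add: v1_def v2_def v3_def vector_4)
  have c34: "v1 $ 3 = p1" "v1 $ 4 = p2" "v2 $ 3 = q1" "v2 $ 4 = q2" "v3 $ 3 = 0" "v3 $ 4 = 0"
    by (simp_all add: v1_def v2_def v3_def vector_4)
  have dist: "v1 \<noteq> v2" "v1 \<noteq> v3" "v2 \<noteq> v3"
    using c1 by auto
  have indep: "independent {v1, v2, v3}"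
  proof (rule independent_if_scalars_zero)
    fix f x
    assume sum: "(\<Sum>x\<in>{v1, v2, v3}. f x *\<^sub>R x) = 0" and x: "x \<in> {v1, v2, v3}"
    have "f v1 *\<^sub>R v1 + f v2 *\<^sub>R v2 + f v3 *\<^sub>R v3 = 0"
      using sum dist by (simp add: add.assoc)
    from arg_cong[OF this, of "\<lambda>x. x $ i" for i]
    have comp: "f v1 * v1 $ i + f v2 * v2 $ i + f v3 * v3 $ i = 0" for i
      by simp
    \<comment> \<open>The second components isolate \<open>v3\<close>; the first ones, opposite for
      \<open>v1\<close> and \<open>v2\<close>, force equal coefficients there.\<close>
    have f3: "f v3 = 0" using comp[of 2] c2 by simp
    have f12: "f v1 = f v2"
      using comp[of 1] c1 by (simp add: f3)
    have 0: "f v1 * (p1 + q1) = 0" "f v1 * (p2 + q2) = 0"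
      using comp[of 3] comp[of 4] by (simp_all only: c34 f3 distrib_left f12[symmetric] mult_zero_left add_0_right)
    \<comment> \<open>The cross product with \<beta> turns the remaining components into the sum of
      the two angular momenta, which are equal and nonzero.\<close>
    have "f v1 * (beta H C t $ 1 * (p2 + q2) - beta H C t $ 2 * (p1 + q1))
        = beta H C t $ 1 * (f v1 * (p2 + q2)) - beta H C t $ 2 * (f v1 * (p1 + q1))"
      by (simp only: right_diff_distrib mult.left_commute)
    also have "\<dots> = 0" by (simp only: 0 mult_zero_right diff_self)
    finally have "f v1 * (beta H C t $ 1 * (p2 + q2) - beta H C t $ 2 * (p1 + q1)) = 0" .
    also have "beta H C t $ 1 * (p2 + q2) - beta H C t $ 2 * (p1 + q1) = 2 * (b t / (sqrt C * G t))"
      using p(3) q(3) by (simp add: algebra_simps)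
    finally have "f v1 = 0"
      using b C_pos G_pos[of t] by auto
    with f12 f3 x show "f x = 0" by auto
  qed simp
  have same: "phi H C (0, t') = phi H C (0, t)"
    by (simp add: phi_eq \<beta>' G')
  have "card {v1, v2, v3} \<le> 2"
  proof (rule embedded_submanifold_card_velocities_le[OF _ indep])
    show "embedded_submanifold 2 (sphere (0::real^4) 1) (range (phi H C))"
      using emb by (simp add: Sigma_embedded_def)
    show "\<exists>\<gamma>. \<gamma> (0::real) = phi H C (0, t) \<and> range \<gamma> \<subseteq> range (phi H C)
        \<and> (\<gamma> has_vector_derivative u) (at 0)" if "u \<in> {v1, v2, v3}" for u
      using that
    proof (elim insertE emptyE)
      assume "u = v1"
      then show ?thesis
        using phi_curve_deriv[OF p(1,2)] unfolding v1_def
        by (intro exI[of _ "\<lambda>\<tau>. phi H C (0, \<tau> + t)"]) auto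
    next
      assume "u = v2"
      then show ?thesis
        using phi_curve_deriv[OF q(1,2)] same unfolding v2_def
        by (intro exI[of _ "\<lambda>\<tau>. phi H C (0, \<tau> + t')"]) auto
    next
      assume "u = v3"
      then show ?thesis
        using phi_circle_deriv unfolding v3_def
        by (intro exI[of _ "\<lambda>\<tau>. phi H C (\<tau>, t)"]) auto
    qed
  qed auto
  then show False using dist by simp
qed

section \<open>The sign of \<open>b\<close> and the existence of a crossing\<close>

lemma b_strict_mono:
  assumes "ts \<le> x" "x < y" "y \<le> te"
  shows "b x < b y"
\<comment> \<open>The open-interval version is used because \<open>v\<close>, and with it b',
  vanishes at \<open>ts\<close> and \<open>te\<close>.\<close>
proof (rule DERIV_pos_imp_increasing_open[OF assms(2)])
  show "\<exists>D. (b has_real_derivative D) (at t) \<and> D > 0" if "x < t" "t < y" for t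
  proof -
    have "2 * H * G t < 0" "v t < 0"
      using H_neg G_pos[of t] v_neg[of t] that assms by (auto simp: mult_neg_pos)
    then show ?thesis using b_deriv mult_neg_neg by blast
  qed
  show "continuous_on {x..y} b"
    by (meson DERIV_continuous_on has_field_derivative_at_within b_deriv)
qed

text \<open>Since \<open>b te\<close> is positive, H C + 1 has the sign of \<open>b ts\<close>; the
  excluded value C = - 1 / H is the case where \<open>b ts\<close> is zero.\<close>

lemma b_prod: "w\<^sup>2 * (b ts * b te) = H * C + 1"
proof -
  have "w\<^sup>2 * (b ts * b te) = H\<^sup>2 * (w\<^sup>2 * (m\<^sup>2 - d\<^sup>2)) + H * (2 * w\<^sup>2 * m) + w\<^sup>2"
    unfolding b_def X_ts X_te by (simp add: power2_eq_square algebra_simps)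
  also have "\<dots> = H * C + 1"
    by (simp only: m_d m_w) (simp only: w_sq, simp add: power2_eq_square algebra_simps)
  finally show ?thesis .
qed

text \<open>The smaller extremal value of \<open>X\<close> lies below the geometric mean 1 / w of
  the two, and 1 / w < 1 / (- H).\<close>

lemma b_te_pos: "b te > 0"
proof -
  have pos: "m - d > 0" using d_less_m by simp
  have "w * (m - d) < 1"
  proof (rule power_less_imp_less_base[of _ 2])
    have "(m - d)\<^sup>2 < m\<^sup>2 - d\<^sup>2"
      using mult_strict_left_mono[of "m - d" "m + d" "m - d"] d_pos pos
      by (simp add: power2_eq_square algebra_simps)
    then have "w\<^sup>2 * (m - d)\<^sup>2 < w\<^sup>2 * (m\<^sup>2 - d\<^sup>2)"
      using w_gt_1 by (intro mult_strict_left_mono) auto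
    then show "(w * (m - d))\<^sup>2 < 1\<^sup>2" by (simp add: m_d power_mult_distrib)
  qed simp
  moreover have "- H * (m - d) < w * (m - d)"
    using w_gt_abs_H pos by (rule mult_strict_right_mono)
  ultimately show ?thesis by (simp add: b_def X_te)
qed

lemma crossing_continuous:
  "continuous_on S (\<lambda>t. sqrt C * v t * cos (\<theta> t - k) + b t * sin (\<theta> t - k))"
proof -
  have "continuous_on S v" "continuous_on S b" "continuous_on S \<theta>"
    by (meson DERIV_continuous_on has_field_derivative_at_within v_deriv b_deriv theta_deriv)+
  note [continuous_intros] = this
  show ?thesis by (intro continuous_intros)
qed

text \<open>Strict signs keep \<open>t\<close> off the endpoints, where \<open>v\<close> or
  \<open>b\<close> may vanish.\<close>

lemma obtain_crossing:
  assumes "x < y"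
    and "sqrt C * v x * cos (\<theta> x - k) + b x * sin (\<theta> x - k) < 0"
    and "sqrt C * v y * cos (\<theta> y - k) + b y * sin (\<theta> y - k) > 0"
  obtains t where "x < t" "t < y" "sqrt C * v t * cos (\<theta> t - k) + b t * sin (\<theta> t - k) = 0"
proof -
  obtain t where t: "x \<le> t" "t \<le> y" "sqrt C * v t * cos (\<theta> t - k) + b t * sin (\<theta> t - k) = 0"
    using IVT'[of "\<lambda>t. sqrt C * v t * cos (\<theta> t - k) + b t * sin (\<theta> t - k)" x 0 y,
        OF less_imp_le[OF assms(2)] less_imp_le[OF assms(3)] less_imp_le[OF assms(1)] crossing_continuous]
    by blast
  then have "t \<noteq> x" "t \<noteq> y" using assms by (metis less_irrefl)+
  with t show thesis by (intro that[of t]) simp_all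
qed

text \<open>The axis belongs to the minimum at \<open>- ts\<close>. As \<open>v\<close> vanishes at
  \<open>ts\<close> and \<open>te\<close>, the crossing function there is
  \<open>b ts * sin (\<theta> te)\<close> and \<open>b te * sin (2 * \<theta> te)\<close>, and the
  bounds on \<open>\<theta> te\<close> make these negative and positive.\<close>

lemma not_embedded_unduloid:
  assumes "H * C > - 1"
  shows "\<not> Sigma_embedded H C"
proof -
  have "w\<^sup>2 * (b ts * b te) > 0" using assms by (simp add: b_prod)
  then have b_ts: "b ts > 0" using b_te_pos by (simp add: zero_less_mult_iff not_less[symmetric])
  have "sin (- \<theta> te) > 0"
    using theta_te_bounds pi_gt_zero by (intro sin_gt_zero) linarith+
  then have "b ts * sin (\<theta> te) < 0"
    using b_ts by (simp add: mult_pos_neg)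
  moreover have "sin (2 * \<theta> te + 2 * pi) > 0"
    using theta_te_bounds by (intro sin_gt_zero) linarith+
  then have "sin (2 * \<theta> te) > 0" by simp
  then have "b te * sin (\<theta> te + \<theta> te) > 0"
    using b_te_pos unfolding mult_2 by (rule mult_pos_pos[rotated])
  ultimately have
    "sqrt C * v ts * cos (\<theta> ts - \<theta> (- ts)) + b ts * sin (\<theta> ts - \<theta> (- ts)) < 0"
    "sqrt C * v te * cos (\<theta> te - \<theta> (- ts)) + b te * sin (\<theta> te - \<theta> (- ts)) > 0"
    by (simp_all add: theta_minus_ts theta_ts v_ts v_te)
  from obtain_crossing[OF ts_less_te this] obtain t where t: "ts < t" "t < te"
    "sqrt C * v t * cos (\<theta> t - \<theta> (- ts)) + b t * sin (\<theta> t - \<theta> (- ts)) = 0" .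
  have "b ts < b t" using t(1,2) by (intro b_strict_mono) auto
  then have "b t \<noteq> 0" using b_ts by linarith
  moreover have "v t \<noteq> 0" using v_neg[OF t(1,2)] by linarith
  ultimately show ?thesis
    by (intro not_embedded_if_crossing[OF cos_c_minus_ts t(3)])
qed

text \<open>The derivative is minus the angular momentum of (y1, y2) divided by its squared length
  \<open>S\<close>, so its sign is opposite to that of \<open>b\<close>.\<close>

lemma arctan_theta_deriv:
  assumes "b t > 0"
  shows "\<exists>D. ((\<lambda>t. arctan (sqrt C * v t / b t) + \<theta> t) has_real_derivative D) (at t) \<and> D < 0"
proof -
  define a' where "a' = sqrt C * (1 / (G t * X t) - w\<^sup>2 * G t)"
  define b' where "b' = 2 * H * G t * v t"
  define S where "S = Q t * (C - X t)"
  have S: "S = (sqrt C * v t)\<^sup>2 + (b t)\<^sup>2"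
    using C_pos by (simp add: S_def power_mult_distrib a_b_sq)
  have "S > 0" using assms by (simp add: S add_nonneg_pos)
  have "((\<lambda>t. sqrt C * v t) has_real_derivative a') (at t)"
    unfolding a'_def by (intro DERIV_cmult v_deriv)
  moreover have "(b has_real_derivative b') (at t)"
    unfolding b'_def by (rule b_deriv)
  ultimately have "((\<lambda>t. arctan (sqrt C * v t / b t) + \<theta> t) has_real_derivative
      (a' * b t - sqrt C * v t * b') / (b t)\<^sup>2 / (1 + (sqrt C * v t / b t)\<^sup>2) + \<theta>' t) (at t)"
    using assms
    by (intro DERIV_cong[OF DERIV_add[OF DERIV_chain2[OF DERIV_arctan DERIV_divide] theta_deriv]])
       (auto simp: divide_inverse power2_eq_square mult_ac)
  also have "1 + (sqrt C * v t / b t)\<^sup>2 = S / (b t)\<^sup>2"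
    using assms by (simp add: S power_divide add_divide_distrib)
  also have "(a' * b t - sqrt C * v t * b') / (b t)\<^sup>2 / (S / (b t)\<^sup>2) + \<theta>' t
      = - (sqrt C * Q t * b t / G t) / S"
  proof -
    define Y where "Y = a' * b t - sqrt C * v t * b'"
    have "Y + S * \<theta>' t = - (sqrt C * Q t * b t / G t)"
      using cross_identity[of t] by (simp add: Y_def a'_def b'_def S_def)
    then have "- (sqrt C * Q t * b t / G t) / S = (Y + S * \<theta>' t) / S"
      by (simp only:)
    also have "\<dots> = Y / S + \<theta>' t"
      using \<open>S > 0\<close> by (simp add: add_divide_distrib)
    also have "Y / S = Y / (b t)\<^sup>2 / (S / (b t)\<^sup>2)"
      using assms by simp
    finally show ?thesis unfolding Y_def by simp
  qed
  finally have "((\<lambda>t. arctan (sqrt C * v t / b t) + \<theta> t) has_real_derivative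
      - (sqrt C * Q t * b t / G t) / S) (at t)" .
  moreover have "- (sqrt C * Q t * b t / G t) / S < 0"
    using C_pos Q_pos[of t] G_pos[of t] assms \<open>S > 0\<close> by simp
  ultimately show ?thesis by blast
qed

text \<open>
  The function \<open>arctan (sqrt C v / b) + \<theta>\<close> is, up to sign and an additive constant, the polar angle
  of \<open>\<beta>\<close>; its arctangent term tends to \<open>- \<pi> / 2\<close> at the zero of \<open>b\<close>.
\<close>
lemma theta_at_zero_of_b:
  assumes tb: "ts < tb" "tb < te" "b tb = 0"
  shows "\<theta> tb - \<theta> te > pi / 2"
proof -
  define B where "B = (\<lambda>t. arctan (sqrt C * v t / b t) + \<theta> t)"
  have b_pos: "b t > 0" if "tb < t" "t \<le> te" for t
    using b_strict_mono[of tb t] tb that by simp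
  have B_mono: "B y < B x" if "tb < x" "x < y" "y \<le> te" for x y
  proof (rule DERIV_neg_imp_decreasing[of x y B])
    fix t assume "x \<le> t" "t \<le> y"
    with that have "b t > 0" by (intro b_pos) auto
    then show "\<exists>D. (B has_real_derivative D) (at t) \<and> D < 0"
      unfolding B_def by (rule arctan_theta_deriv)
  qed (rule that(2))
  \<comment> \<open>The limit at \<open>tb\<close> only yields a weak inequality; comparing with an
    intermediate point makes the result strict.\<close>
  define t1 where "t1 = (tb + te) / 2"
  have t1: "tb < t1" "t1 < te" using tb by (auto simp: t1_def)
  have "B te = \<theta> te" by (simp add: B_def v_te)
  then have B1: "B t1 > \<theta> te" using B_mono[of t1 te] t1 by simp
  have cont: "(v \<longlongrightarrow> v tb) (at_right tb)" "(b \<longlongrightarrow> b tb) (at_right tb)" "(\<theta> \<longlongrightarrow> \<theta> tb) (at_right tb)"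
    using DERIV_isCont[OF v_deriv] DERIV_isCont[OF b_deriv] DERIV_isCont[OF theta_deriv]
    by (simp_all add: isCont_def tendsto_within_subset[OF _ subset_UNIV])
  have "\<forall>\<^sub>F t in at_right tb. t \<in> {tb<..<t1}"
    using t1(1) by (rule eventually_at_right_real)
  then have ev: "\<forall>\<^sub>F t in at_right tb. tb < t \<and> t < t1" by simp
  have "filterlim (\<lambda>t. inverse (b t)) at_top (at_right tb)"
    using cont(2) ev b_pos t1 unfolding tb(3)
    by (intro filterlim_inverse_at_top) (auto elim!: eventually_mono)
  moreover have "((\<lambda>t. sqrt C * v t) \<longlongrightarrow> sqrt C * v tb) (at_right tb)"
    by (intro tendsto_intros cont)
  moreover have "sqrt C * v tb < 0"
    using v_neg[OF tb(1,2)] C_pos by (simp add: mult_pos_neg)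
  ultimately have "filterlim (\<lambda>t. sqrt C * v t * inverse (b t)) at_bot (at_right tb)"
    by (intro filterlim_tendsto_neg_mult_at_bot)
  then have "((\<lambda>t. arctan (sqrt C * v t / b t)) \<longlongrightarrow> - (pi / 2)) (at_right tb)"
    unfolding divide_inverse[of _ "b _"] by (rule filterlim_compose[OF tendsto_arctan_at_bot])
  then have "(B \<longlongrightarrow> - (pi / 2) + \<theta> tb) (at_right tb)"
    unfolding B_def using cont(3) by (rule tendsto_add)
  moreover have "\<forall>\<^sub>F t in at_right tb. B t1 \<le> B t"
    using ev by eventually_elim (use B_mono t1 in \<open>auto intro: less_imp_le\<close>)
  ultimately have "B t1 \<le> - (pi / 2) + \<theta> tb"
    by (rule tendsto_lowerbound) simp
  with B1 show ?thesis by simp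
qed

text \<open>The axis belongs to the minimum at \<open>te\<close>, and the search runs from
  \<open>ts\<close> to the zero \<open>tb\<close> of \<open>b\<close>. At \<open>ts\<close> only the
  sine term survives; at \<open>tb\<close> only the cosine term, whose angle lies between pi / 2 and
  pi.\<close>

lemma not_embedded_nodoid:
  assumes "H * C < - 1"
  shows "\<not> Sigma_embedded H C"
proof -
  have "w\<^sup>2 * (b ts * b te) < 0" using assms by (simp add: b_prod)
  then have b_ts: "b ts < 0" using b_te_pos w_gt_1 by (auto simp: mult_less_0_iff)
  have "continuous_on {ts..te} b"
    by (meson DERIV_continuous_on has_field_derivative_at_within b_deriv)
  then obtain tb where tb: "ts \<le> tb" "tb \<le> te" "b tb = 0"
    using IVT'[of b ts 0 te] less_imp_le[OF b_ts] less_imp_le[OF b_te_pos] less_imp_le[OF ts_less_te]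
    by blast
  then have tb_neq: "ts < tb" "tb < te"
    using b_ts b_te_pos by (auto simp: le_less)
  have "\<theta> tb < 0" using theta_strict_antimono[OF tb_neq(1)] by (simp add: theta_ts)
  then have "\<theta> tb - \<theta> te < pi" using theta_te_bounds by linarith
  moreover have "\<theta> tb - \<theta> te > pi / 2"
    using theta_at_zero_of_b tb_neq tb by blast
  ultimately have "cos (\<theta> tb - \<theta> te - pi) > 0"
    by (intro cos_gt_zero_pi) auto
  then have "cos (\<theta> tb - \<theta> te) < 0" by (simp add: cos_diff[of _ pi])
  then have "sqrt C * v tb * cos (\<theta> tb - \<theta> te) > 0"
    using v_neg[OF tb_neq] C_pos by (simp add: mult_pos_neg mult_neg_neg)
  moreover have "sin (- \<theta> te) > 0"
    using theta_te_bounds pi_gt_zero by (intro sin_gt_zero) linarith+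
  then have "b ts * sin (- \<theta> te) < 0" using b_ts mult_neg_pos by blast
  ultimately have
    "sqrt C * v ts * cos (\<theta> ts - \<theta> te) + b ts * sin (\<theta> ts - \<theta> te) < 0"
    "sqrt C * v tb * cos (\<theta> tb - \<theta> te) + b tb * sin (\<theta> tb - \<theta> te) > 0"
    by (simp_all add: theta_ts v_ts tb)
  from obtain_crossing[OF tb_neq(1) this] obtain t where t: "ts < t" "t < tb"
    "sqrt C * v t * cos (\<theta> t - \<theta> te) + b t * sin (\<theta> t - \<theta> te) = 0" .
  have "b t < b tb" using t(1,2) tb(2) by (intro b_strict_mono) auto
  then have "b t \<noteq> 0" using tb(3) by linarith
  moreover have "v t < 0" using t(1,2) tb_neq(2) by (intro v_neg) auto
  then have "v t \<noteq> 0" by linarith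
  ultimately show ?thesis
    by (intro not_embedded_if_crossing[OF cos_c_te t(3)])
qed

end

theorem theorem6p2:
  fixes H C :: real
  assumes "H < 0"
    and "C > 2 * (H + sqrt (1 + H\<^sup>2))"
    and "C \<noteq> - (1 / H)"
  shows "\<not> Sigma_embedded H C"
proof -
  interpret delaunay_profile H C
    using assms(1,2) by unfold_locales
  have "H * C \<noteq> - 1"
    using assms(1,3) by (metis divide_minus_left less_irrefl nonzero_mult_div_cancel_left)
  then show ?thesis
    using not_embedded_unduloid not_embedded_nodoid by linarith
qed

end
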